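(* For all integers $n,r,j\ge 1$, $$p^r_j(n)=p^{r-1}_j(n)+\sum_{s=0}^{n-1}\binom{n}{s}\,p^{r-1}_j(s).$$
   Context: A preferential arrangement of a finite set $S$ is an ordered set partition of $S$ (a sequence of nonempty pairwise disjoint blocks with union $S$); the empty set has exactly one. Let $a(w)$ be the number of preferential arrangements of a $w$-element set ($a(0)=1$). A barred preferential arrangement of $X_n=\{1,\dots,n\}$ with $k$ bars is a sequence of $k+1$ possibly empty, pairwise disjoint sections with union $X_n$, each equipped with a preferential arrangement of its elements. A restricted section is one whose preferential arrangement has at most one block (exactly one choice); a free section may carry any preferential arrangement. For integers $r,j\ge0$ with $r+j\ge1$, $p^r_j(n)$ is the number of barred preferential arrangements of $X_n$ with $r+j$ sections ($r+j-1$ bars) in which $r$ fixed sections are restricted and $j$ fixed sections are free; equivalently $p^r_j(n)=\sum_{w_1+\cdots+w_{r+j}=n}\frac{n!}{w_1!\cdots w_{r+j}!}\prod_{i=r+1}^{r+j}a(w_i)$ (sum over nonnegative integer solutions). *)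

theory Defs
  imports "HOL-Library.Disjoint_Sets"
begin

text \<open>
  An ordered set partition is the list of its blocks; \<open>distinct\<close> is needed because
  \<open>partition_on\<close> only sees the set of blocks. The empty set has exactly the arrangement \<open>[]\<close>.
\<close>

definition preferential_arrangements :: "'a set \<Rightarrow> 'a set list set" where
  "preferential_arrangements S = {bs. distinct bs \<and> partition_on S (set bs)}"

text \<open>
  With \<open>k\<close> bars: the list of the \<open>k + 1\<close> sections, the \<open>i\<close>-th section being given by
  the preferential arrangement of its (possibly empty) element set \<open>S i\<close>.
\<close>

definition barred_preferential_arrangements :: "nat \<Rightarrow> 'a set \<Rightarrow> 'a set list list set" where
  "barred_preferential_arrangements k X =
    {xs. length xs = k + 1 \<and>
      (\<exists>S. disjoint_family_on S {..<k + 1} \<and> (\<Union>i<k + 1. S i) = X \<and>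
        (\<forall>i<k + 1. xs ! i \<in> preferential_arrangements (S i)))}"

text \<open>
  The number \<open>p\<^sup>r\<^sub>j(n)\<close>. The fixed restricted sections are the first \<open>r\<close> ones, the
  remaining \<open>j\<close> are free. Only meaningful for \<open>r + j \<ge> 1\<close> (truncated subtraction).
\<close>

definition p :: "nat \<Rightarrow> nat \<Rightarrow> nat \<Rightarrow> nat" where
  "p r j n =
    card {xs \<in> barred_preferential_arrangements (r + j - 1) {1..n}.
      \<forall>i<r. length (xs ! i) \<le> 1}"

end

theory Submission imports Defs begin

text \<open>
  Deleting the first, restricted section of an arrangement of \<open>X\<close> leaves an arrangement of some
  \<open>T \<subseteq> X\<close>, and the deleted section, \<open>[]\<close> or \<open>[X - T]\<close>, is recovered from \<open>T\<close>. Grouping the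
  subsets \<open>T\<close> by cardinality \<open>s\<close> gives the recurrence, with the separate first term for \<open>s = n\<close>.
\<close>

text \<open>The set counted by \<open>p\<close>, but over an arbitrary ground set, since subsets
  \<open>T\<close> of \<open>X\<close> arise in the recursion. Keeping \<open>k\<close> separate
  from \<open>r\<close> avoids truncated subtraction.\<close>

definition restricted_arrangements :: "nat \<Rightarrow> nat \<Rightarrow> 'a set \<Rightarrow> 'a set list list set" where
  "restricted_arrangements r k X =
    {xs \<in> barred_preferential_arrangements k X. \<forall>i<r. length (xs ! i) \<le> 1}"

lemma p_eq_card_restricted: "p r j n = card (restricted_arrangements r (r + j - 1) {1..n})"
  by (simp add: p_def restricted_arrangements_def)

text \<open>The ground set can be read off the list alone, because the blocks of section
  \<open>i\<close> cover \<open>S i\<close>. Arrangements of different sets are therefore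
  different.\<close>

lemma Union_barred:
  assumes "xs \<in> barred_preferential_arrangements k X"
  shows "(\<Union>bs\<in>set xs. \<Union>(set bs)) = X"
proof -
  from assms obtain S where len: "length xs = k + 1" and un: "(\<Union>i<k + 1. S i) = X"
    and mem: "\<forall>i<k + 1. xs ! i \<in> preferential_arrangements (S i)"
    unfolding barred_preferential_arrangements_def by blast
  have "set xs = (!) xs ` {..<k + 1}"
    using len by (auto simp: set_conv_nth)
  then have "(\<Union>bs\<in>set xs. \<Union>(set bs)) = (\<Union>i<k + 1. \<Union>(set (xs ! i)))"
    by simp
  also have "\<dots> = (\<Union>i<k + 1. S i)"
    using mem by (intro SUP_cong) (auto simp: preferential_arrangements_def partition_on_def)
  finally show ?thesis
    using un by simp
qed

lemma finite_barred_preferential_arrangements: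
  assumes "finite X"
  shows "finite (barred_preferential_arrangements k X)"
proof (rule finite_subset)
  let ?B = "{bs. set bs \<subseteq> Pow X \<and> distinct bs}"
  show "finite {xs. set xs \<subseteq> ?B \<and> length xs = k + 1}"
    using assms by (intro finite_lists_length_eq finite_subset_distinct) simp
  show "barred_preferential_arrangements k X \<subseteq> {xs. set xs \<subseteq> ?B \<and> length xs = k + 1}"
  proof
    fix xs assume xs: "xs \<in> barred_preferential_arrangements k X"
    then have "length xs = k + 1" "\<forall>bs\<in>set xs. distinct bs"
      by (auto simp: barred_preferential_arrangements_def preferential_arrangements_def
          in_set_conv_nth)
    with Union_barred[OF xs] show "xs \<in> {xs. set xs \<subseteq> ?B \<and> length xs = k + 1}"
      by blast
  qed
qed

lemma finite_restricted_arrangements: "finite X \<Longrightarrow> finite (restricted_arrangements r k X)"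
  by (simp add: restricted_arrangements_def finite_barred_preferential_arrangements)

lemma map_image_preferential_arrangements:
  assumes "bs \<in> preferential_arrangements S" and "inj_on f S"
  shows "map ((`) f) bs \<in> preferential_arrangements (f ` S)"
proof -
  from assms(1) have "distinct bs" and part: "partition_on S (set bs)"
    by (auto simp: preferential_arrangements_def)
  have "set bs \<subseteq> Pow S"
    using part by (auto simp: partition_on_def)
  then have "inj_on ((`) f) (set bs)"
    using inj_on_image_Pow[OF assms(2)] by (rule inj_on_subset[rotated])
  with \<open>distinct bs\<close> have "distinct (map ((`) f) bs)"
    by (simp add: distinct_map)
  moreover have "partition_on (f ` S) ((`) f ` set bs)"
  proof -
    \<comment> \<open>\<open>partition_on_inj_image\<close> removes the empty set from the image
      partition; as images of blocks are nonempty, nothing is lost.\<close>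
    have "{} \<notin> (`) f ` set bs"
      using part by (auto simp: partition_on_def)
    with partition_on_inj_image[OF part assms(2)] show ?thesis
      by simp
  qed
  ultimately show ?thesis
    by (simp add: preferential_arrangements_def)
qed

lemma map_image_restricted_arrangements:
  assumes "xs \<in> restricted_arrangements r k X" and inj: "inj_on f X" and "r \<le> k + 1"
  shows "map (map ((`) f)) xs \<in> restricted_arrangements r k (f ` X)"
proof -
  from assms(1) obtain S where len: "length xs = k + 1"
    and disj: "disjoint_family_on S {..<k + 1}" and un: "(\<Union>i<k + 1. S i) = X"
    and mem: "\<forall>i<k + 1. xs ! i \<in> preferential_arrangements (S i)"
    and le: "\<forall>i<r. length (xs ! i) \<le> 1"
    unfolding restricted_arrangements_def barred_preferential_arrangements_def by blast
  have sub: "S i \<subseteq> X" if "i < k + 1" for i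
    using un that by blast
  have "disjoint_family_on (\<lambda>i. f ` S i) {..<k + 1}"
    unfolding disjoint_family_on_def
  proof (intro ballI impI)
    fix m n assume mn: "m \<in> {..<k + 1}" "n \<in> {..<k + 1}" "m \<noteq> n"
    with disj have "S m \<inter> S n = {}"
      unfolding disjoint_family_on_def by blast
    with mn show "f ` S m \<inter> f ` S n = {}"
      using inj_on_image_Int[OF inj sub sub, of m n] by simp
  qed
  moreover have "(\<Union>i<k + 1. f ` S i) = f ` X"
    using un by blast
  moreover have "map (map ((`) f)) xs ! i \<in> preferential_arrangements (f ` S i)"
    if "i < k + 1" for i
    using mem len that inj_on_subset[OF inj sub[OF that]]
    by (simp add: map_image_preferential_arrangements)
  ultimately show ?thesis
    using len le \<open>r \<le> k + 1\<close>
    unfolding restricted_arrangements_def barred_preferential_arrangements_def by auto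
qed

text \<open>Every block lies in \<open>X\<close> by \<open>Union_barred\<close>, so a left inverse
  on \<open>X\<close> suffices to undo the relabelling.\<close>

lemma map_image_cancel:
  assumes "xs \<in> restricted_arrangements r k X" and "\<And>x. x \<in> X \<Longrightarrow> g (f x) = x"
  shows "map (map ((`) g)) (map (map ((`) f)) xs) = xs"
proof -
  have "(\<Union>bs\<in>set xs. \<Union>(set bs)) = X"
    using assms(1) by (intro Union_barred[of _ k]) (simp add: restricted_arrangements_def)
  then have sub: "b \<subseteq> X" if "bs \<in> set xs" "b \<in> set bs" for bs b
    using that by blast
  have "g ` f ` b = b" if "b \<subseteq> X" for b
    using that assms(2) by (simp add: image_image subset_iff)
  with sub have "map ((`) g) (map ((`) f) bs) = bs" if "bs \<in> set xs" for bs
    unfolding map_map comp_def using that by (intro map_idI) blast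
  then show ?thesis
    unfolding map_map[of "map ((`) g)"] comp_def by (intro map_idI)
qed

text \<open>This reduces counts over subsets \<open>T\<close> to values of \<open>p\<close>, which
  is defined on initial segments only. Relabelling by \<open>f\<close> is inverted by relabelling
  with \<open>inv_into X f\<close>.\<close>

lemma card_restricted_arrangements_cong:
  assumes "bij_betw f X Y" and "r \<le> k + 1"
  shows "card (restricted_arrangements r k X) = card (restricted_arrangements r k Y)"
proof (rule bij_betw_same_card)
  let ?g = "inv_into X f"
  have f: "inj_on f X" "f ` X = Y"
    using assms(1) by (auto simp: bij_betw_def)
  have g: "inj_on ?g Y" "?g ` Y = X"
    using bij_betw_inv_into[OF assms(1)] by (auto simp: bij_betw_def)
  have gf: "?g (f x) = x" if "x \<in> X" for x
    using f that by simp
  have fg: "f (?g y) = y" if "y \<in> Y" for y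
    using f that by (auto intro: f_inv_into_f)
  show "bij_betw (map (map ((`) f))) (restricted_arrangements r k X) (restricted_arrangements r k Y)"
  proof (rule bij_betw_byWitness[where f' = "map (map ((`) ?g))"])
    show "\<forall>xs\<in>restricted_arrangements r k X. map (map ((`) ?g)) (map (map ((`) f)) xs) = xs"
      using map_image_cancel gf by blast
    show "\<forall>ys\<in>restricted_arrangements r k Y. map (map ((`) f)) (map (map ((`) ?g)) ys) = ys"
      using map_image_cancel fg by blast
    show "map (map ((`) f)) ` restricted_arrangements r k X \<subseteq> restricted_arrangements r k Y"
      using map_image_restricted_arrangements[OF _ f(1) assms(2)] f(2) by auto
    show "map (map ((`) ?g)) ` restricted_arrangements r k Y \<subseteq> restricted_arrangements r k X"
      using map_image_restricted_arrangements[OF _ g(1) assms(2)] g(2) by auto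
  qed
qed

text \<open>\<open>T\<close> is the union of the remaining sections; disjointness leaves exactly
  \<open>X - T\<close> for the first one.\<close>

lemma Cons_barred_iff:
  "bs # xs \<in> barred_preferential_arrangements (Suc k) X \<longleftrightarrow>
    (\<exists>T\<subseteq>X. bs \<in> preferential_arrangements (X - T) \<and> xs \<in> barred_preferential_arrangements k T)"
    (is "?L \<longleftrightarrow> ?R")
proof
  assume ?L
  then obtain S where len: "length xs = k + 1"
    and disj: "disjoint_family_on S {..<Suc (k + 1)}" and un: "(\<Union>i<Suc (k + 1). S i) = X"
    and mem: "\<forall>i<Suc (k + 1). (bs # xs) ! i \<in> preferential_arrangements (S i)"
    unfolding barred_preferential_arrangements_def by auto
  let ?T = "\<Union>i<k + 1. S (Suc i)"
  have X: "S 0 \<union> ?T = X"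
    using un by (simp only: lessThan_Suc_eq_insert_0) (simp add: image_image)
  have "S 0 \<inter> S (Suc i) = {}" if "i < k + 1" for i
    using disj that unfolding disjoint_family_on_def by auto
  then have "S 0 = X - ?T"
    using X by blast
  have "disjoint_family_on (\<lambda>i. S (Suc i)) {..<k + 1}"
    using disj unfolding disjoint_family_on_def by auto
  moreover have "\<forall>i<k + 1. xs ! i \<in> preferential_arrangements (S (Suc i))"
    using mem by (auto simp: All_less_Suc2)
  ultimately have "xs \<in> barred_preferential_arrangements k ?T"
    using len unfolding barred_preferential_arrangements_def
    by (intro CollectI conjI exI[of _ "\<lambda>i. S (Suc i)"]) simp_all
  then show ?R
    using X mem \<open>S 0 = X - ?T\<close> by (intro exI[of _ ?T]) auto
next
  assume ?R
  then obtain T S where "T \<subseteq> X" and bs: "bs \<in> preferential_arrangements (X - T)"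
    and len: "length xs = k + 1"
    and disj: "disjoint_family_on S {..<k + 1}" and un: "(\<Union>i<k + 1. S i) = T"
    and mem: "\<forall>i<k + 1. xs ! i \<in> preferential_arrangements (S i)"
    unfolding barred_preferential_arrangements_def by blast
  \<comment> \<open>The element set of the new section goes to index 0 and the old family is shifted
    by one.\<close>
  let ?S = "case_nat (X - T) S"
  have "disjoint_family_on ?S {..<Suc (k + 1)}"
    using disj un unfolding disjoint_family_on_def by (auto split: nat.splits)
  moreover have "(\<Union>i<Suc (k + 1). ?S i) = X"
    using un \<open>T \<subseteq> X\<close> by (simp only: lessThan_Suc_eq_insert_0) (auto simp: image_image)
  moreover have "\<forall>i<Suc (k + 1). (bs # xs) ! i \<in> preferential_arrangements (?S i)"
    using bs mem by (auto simp: nth_Cons split: nat.splits)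
  ultimately show ?L
    using len unfolding barred_preferential_arrangements_def by auto
qed

text \<open>A restricted section has no freedom: blocks are nonempty, so the empty set forces
  \<open>[]\<close>, and otherwise a single block must be all of \<open>U\<close>.\<close>

lemma single_block_arrangement_iff:
  "bs \<in> preferential_arrangements U \<and> length bs \<le> 1 \<longleftrightarrow> bs = (if U = {} then [] else [U])"
  by (cases bs) (auto simp: preferential_arrangements_def partition_on_def)

lemma Cons_restricted_iff:
  "bs # xs \<in> restricted_arrangements (Suc r) (Suc k) X \<longleftrightarrow>
    (\<exists>T\<subseteq>X. bs = (if X - T = {} then [] else [X - T]) \<and> xs \<in> restricted_arrangements r k T)"
  \<comment> \<open>With the forced form of \<open>bs\<close> turned back into a length bound, it
    remains to split index 0 off the length condition and apply
    \<open>Cons_barred_iff\<close>.\<close>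
  unfolding single_block_arrangement_iff[symmetric]
  by (auto simp: restricted_arrangements_def Cons_barred_iff All_less_Suc2)

text \<open>The arrangements are classified by the set \<open>T\<close> that the tail arranges.
  Within a class the first section is fixed, so prepending it is injective.\<close>

lemma card_restricted_arrangements_Suc:
  assumes "finite X"
  shows "card (restricted_arrangements (Suc r) (Suc k) X) =
    (\<Sum>T\<in>Pow X. card (restricted_arrangements r k T))"
proof -
  let ?h = "\<lambda>T xs. (if X - T = {} then [] else [X - T]) # xs"
  let ?R = "restricted_arrangements r k"
  have ne: "xs \<noteq> []" if "xs \<in> restricted_arrangements (Suc r) (Suc k) X" for xs :: "'a set list list"
    using that by (auto simp: restricted_arrangements_def barred_preferential_arrangements_def)
  have "restricted_arrangements (Suc r) (Suc k) X = (\<Union>T\<in>Pow X. ?h T ` ?R T)" (is "?A = ?B")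
  proof (rule set_eqI)
    fix xs show "xs \<in> ?A \<longleftrightarrow> xs \<in> ?B"
      by (cases xs) (use ne in \<open>auto simp: Cons_restricted_iff\<close>)
  qed
  also have "card \<dots> = (\<Sum>T\<in>Pow X. card (?h T ` ?R T))"
  proof (rule card_UN_disjoint)
    show "\<forall>T\<in>Pow X. finite (?h T ` ?R T)"
      using assms by (auto intro!: finite_restricted_arrangements dest: finite_subset)
    \<comment> \<open>The tail determines its ground set, so distinct classes share no list.\<close>
    have "T = U" if "xs \<in> ?R T" "xs \<in> ?R U" for xs T U
      using that Union_barred[of xs k T] Union_barred[of xs k U]
      by (simp add: restricted_arrangements_def)
    then show "\<forall>T\<in>Pow X. \<forall>U\<in>Pow X. T \<noteq> U \<longrightarrow> ?h T ` ?R T \<inter> ?h U ` ?R U = {}"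
      by blast
  qed (use assms in simp)
  also have "\<dots> = (\<Sum>T\<in>Pow X. card (?R T))"
    by (intro sum.cong card_image) (auto simp: inj_on_def)
  finally show ?thesis .
qed

lemma sum_Pow_card:
  fixes g :: "nat \<Rightarrow> nat"
  assumes "finite X"
  shows "(\<Sum>T\<in>Pow X. g (card T)) = (\<Sum>s\<le>card X. (card X choose s) * g s)"
proof -
  have "(\<Sum>T\<in>Pow X. g (card T)) = (\<Sum>s\<le>card X. \<Sum>T\<in>{T \<in> Pow X. card T = s}. g (card T))"
    using assms by (intro sum.group[symmetric]) (auto intro: card_mono)
  also have "\<dots> = (\<Sum>s\<le>card X. (card X choose s) * g s)"
    using assms by (intro sum.cong) (simp_all add: n_subsets)
  finally show ?thesis .
qed

theorem theorem8:
  fixes n r j :: nat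
  assumes "n \<ge> 1" and "r \<ge> 1" and "j \<ge> 1"
  shows "p r j n = p (r - 1) j n + (\<Sum>s = 0..n - 1. (n choose s) * p (r - 1) j s)"
proof -
  \<comment> \<open>Writing \<open>j\<close> as a successor makes the bar counts exact:
    \<open>r + j - 1\<close> is \<open>Suc (q + i)\<close> and \<open>q + j - 1\<close> is
    \<open>q + i\<close>.\<close>
  obtain q i where r: "r = Suc q" and j: "j = Suc i"
    using assms by (metis One_nat_def Suc_le_D)
  have card: "card (restricted_arrangements q (q + i) T) = p q j (card T)"
    if T: "T \<subseteq> {1..n}" for T
  proof -
    have "finite T"
      using T finite_subset by blast
    then obtain f where "bij_betw f T {1..card T}"
      using finite_same_card_bij[of T "{1..card T}"] by auto
    then show ?thesis
      by (simp add: card_restricted_arrangements_cong p_eq_card_restricted j)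
  qed
  have "p r j n = (\<Sum>T\<in>Pow {1..n}. card (restricted_arrangements q (q + i) T))"
    using card_restricted_arrangements_Suc[of "{1..n}" q "q + i"]
    by (simp add: p_eq_card_restricted r j)
  also have "\<dots> = (\<Sum>T\<in>Pow {1..n}. p q j (card T))"
    using card by (intro sum.cong) auto
  also have "\<dots> = (\<Sum>s\<le>n. (n choose s) * p q j s)"
    using sum_Pow_card[of "{1..n}"] by simp
  \<comment> \<open>The term \<open>s = n\<close> has binomial coefficient 1. For
    \<open>n = 0\<close> truncation would put \<open>n\<close> into \<open>{0..n - 1}\<close>, so
    \<open>n \<ge> 1\<close> is used here and in the next step.\<close>
  also have "{..n} = insert n {0..n - 1}"
    using \<open>n \<ge> 1\<close> by auto
  also have "(\<Sum>s\<in>insert n {0..n - 1}. (n choose s) * p q j s)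
      = p q j n + (\<Sum>s = 0..n - 1. (n choose s) * p q j s)"
    using \<open>n \<ge> 1\<close> by (subst sum.insert) auto
  finally show ?thesis
    by (simp add: r)
qed

end
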